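(* Let $\mathcal{T}=(U,\ell)$ and $\mathcal{T}'=(U',\ell')$ be labelled binary trees. For all $w\in U$, $w'\in U'$ and $\varepsilon\in[0,1]$, the position $(w,w',\varepsilon)$ is winning for Verifier in the bisimulation distance game between $\mathcal{T}$ and $\mathcal{T}'$ if and only if $\mathrm{bd}(\mathcal{T}_w,\mathcal{T}'_{w'})\le\varepsilon$.
   Context: Labels: $\Sigma=\Sigma_0\uplus\Sigma_2$. A labelled binary tree $(U,\ell)$: $U\subseteq\{0,1\}^*$ prefix-closed and sibling-closed ($w.0\in U\iff w.1\in U$), $\ell:U\to\Sigma$ with $\ell(w)\in\Sigma_2\iff w.0,w.1\in U$. $\mathcal{T}_w$ denotes the subtree rooted at $w$ (domain $\{v: wv\in U\}$, labelling $v\mapsto\ell(wv)$). For a set $X$, $FX=\Sigma_0\uplus(\Sigma_2\times X\times X)$; the successor function is $\gamma(w)=\ell(w)$ if $\ell(w)\in\Sigma_0$, and $\gamma(w)=(\ell(w),w.0,w.1)$ otherwise ($\gamma'$ similarly for $\mathcal{T}'$). Fix an order-preserving $f:[0,1]\times[0,1]\to[0,1]$. For $d:X\times Y\to[0,1]$, its lifting $\bar d:FX\times FY\to[0,1]$ is: $0$ if $\alpha=\beta\in\Sigma_0$; $f(d(x_1,y_1),d(x_2,y_2))$ if $\alpha=(\sigma,x_1,x_2),\beta=(\sigma,y_1,y_2)$ with the same $\sigma\in\Sigma_2$; $1$ otherwise. A function $d:U\times U'\to[0,1]$ is a bisimulation distance function if $d(w,w')\ge\bar d(\gamma(w),\gamma'(w'))$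 for all $w,w'$. Let $d^*$ be the pointwise least bisimulation distance function (exists by Knaster–Tarski) and $\mathrm{bd}(\mathcal{T}_w,\mathcal{T}'_{w'})=d^*(w,w')$. Bisimulation distance game: at position $(w,w',\varepsilon_1)\in U\times U'\times[0,1]$ Verifier chooses $d:U\times U'\to[0,1]$ with $\bar d(\gamma(w),\gamma'(w'))\le\varepsilon_1$; then Falsifier chooses any $(v,v',\varepsilon_2)\in U\times U'\times[0,1]$ with $d(v,v')\le\varepsilon_2$, which is the next position. A player who cannot move loses; infinite plays are won by Verifier. *)

theory Defs
  imports Complex_Main "HOL-Library.FuncSet" "HOL-Library.Sublist" "HOL-Library.Product_Order"
begin

section \<open>Labelled binary trees\<close>

text \<open>
  Words over \<open>{0,1}\<close> are boolean lists, with \<open>0\<close> as \<^term>\<open>False\<close> and \<open>1\<close> as \<^term>\<open>True\<close>.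
  The label set is the disjoint union of \<open>'a\<close> (the labels of arity 0) and \<open>'b\<close> (arity 2).
  Only the values of \<open>label\<close> on \<open>nodes\<close> are relevant.
\<close>

type_synonym word = "bool list"

record ('a, 'b) ltree =
  nodes :: "word set"
  label :: "word \<Rightarrow> 'a + 'b"

definition labelled_binary_tree :: "('a, 'b) ltree \<Rightarrow> bool" where
  "labelled_binary_tree T \<longleftrightarrow>
     (\<forall>v w. prefix v w \<longrightarrow> w \<in> nodes T \<longrightarrow> v \<in> nodes T) \<and>
     (\<forall>w. w @ [False] \<in> nodes T \<longleftrightarrow> w @ [True] \<in> nodes T) \<and>
     (\<forall>w\<in>nodes T. label T w \<in> range Inr \<longleftrightarrow> w @ [False] \<in> nodes T \<and> w @ [True] \<in> nodes T)"

definition subtree :: "('a, 'b) ltree \<Rightarrow> word \<Rightarrow> ('a, 'b) ltree" where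
  "subtree T w = \<lparr>nodes = {v. w @ v \<in> nodes T}, label = (\<lambda>v. label T (w @ v))\<rparr>"

type_synonym ('a, 'b, 'x) succs = "'a + ('b \<times> 'x \<times> 'x)"

definition successor :: "('a, 'b) ltree \<Rightarrow> word \<Rightarrow> ('a, 'b, word) succs" where
  "successor T w =
     (case label T w of Inl a \<Rightarrow> Inl a | Inr b \<Rightarrow> Inr (b, w @ [False], w @ [True]))"


section \<open>Bisimulation distance\<close>

definition lifting ::
    "(real \<times> real \<Rightarrow> real) \<Rightarrow> ('x \<times> 'y \<Rightarrow> real) \<Rightarrow>
     ('a, 'b, 'x) succs \<Rightarrow> ('a, 'b, 'y) succs \<Rightarrow> real" where
  "lifting f d \<alpha> \<beta> =
     (case (\<alpha>, \<beta>) of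
        (Inl a, Inl a') \<Rightarrow> if a = a' then 0 else 1
      | (Inr (b, x1, x2), Inr (b', y1, y2)) \<Rightarrow>
          if b = b' then f (d (x1, y1), d (x2, y2)) else 1
      | _ \<Rightarrow> 1)"

text \<open>
  Functions from \<open>U \<times> U'\<close> to \<open>[0,1]\<close> are represented by total functions that are
  undefined outside \<open>U \<times> U'\<close>, so that equality is equality on \<open>U \<times> U'\<close>.
\<close>

definition dist_funs ::
    "('a, 'b) ltree \<Rightarrow> ('a, 'b) ltree \<Rightarrow> (word \<times> word \<Rightarrow> real) set" where
  "dist_funs T T' = nodes T \<times> nodes T' \<rightarrow>\<^sub>E {0..1}"

definition bisim_dist ::
    "(real \<times> real \<Rightarrow> real) \<Rightarrow> ('a, 'b) ltree \<Rightarrow> ('a, 'b) ltree \<Rightarrow>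
     (word \<times> word \<Rightarrow> real) \<Rightarrow> bool" where
  "bisim_dist f T T' d \<longleftrightarrow>
     d \<in> dist_funs T T' \<and>
     (\<forall>w\<in>nodes T. \<forall>w'\<in>nodes T'. d (w, w') \<ge> lifting f d (successor T w) (successor T' w'))"

definition is_least_bisim_dist ::
    "(real \<times> real \<Rightarrow> real) \<Rightarrow> ('a, 'b) ltree \<Rightarrow> ('a, 'b) ltree \<Rightarrow>
     (word \<times> word \<Rightarrow> real) \<Rightarrow> bool" where
  "is_least_bisim_dist f T T' d \<longleftrightarrow>
     bisim_dist f T T' d \<and>
     (\<forall>d'. bisim_dist f T T' d' \<longrightarrow> (\<forall>p\<in>nodes T \<times> nodes T'. d p \<le> d' p))"

definition least_bisim_dist ::
    "(real \<times> real \<Rightarrow> real) \<Rightarrow> ('a, 'b) ltree \<Rightarrow> ('a, 'b) ltree \<Rightarrow>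
     (word \<times> word \<Rightarrow> real)" where
  "least_bisim_dist f T T' = (THE d. is_least_bisim_dist f T T' d)"

text \<open>
  \<open>bd f T T' w w'\<close> is the bisimulation distance of the subtrees of \<open>T\<close> and \<open>T'\<close> rooted
  at \<open>w\<close> and \<open>w'\<close>; lemma \<open>bd_subtree\<close> shows that it depends only on these subtrees.
\<close>

definition bd ::
    "(real \<times> real \<Rightarrow> real) \<Rightarrow> ('a, 'b) ltree \<Rightarrow> ('a, 'b) ltree \<Rightarrow> word \<Rightarrow> word \<Rightarrow> real" where
  "bd f T T' w w' = least_bisim_dist f T T' (w, w')"

lemma label_children:
  assumes "labelled_binary_tree T" "w \<in> nodes T" "label T w = Inr b"
  shows "w @ [False] \<in> nodes T" "w @ [True] \<in> nodes T"
  using assms unfolding labelled_binary_tree_def by (metis rangeI)+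

lemma lifting_mono:
  assumes f: "mono_on ({0..1} \<times> {0..1}) f"
    and T: "labelled_binary_tree T" "labelled_binary_tree T'"
    and w: "w \<in> nodes T" "w' \<in> nodes T'"
    and d: "d \<in> nodes T \<times> nodes T' \<rightarrow> {0..1}" and d': "d' \<in> nodes T \<times> nodes T' \<rightarrow> {0..1}"
    and le: "\<And>v v'. v \<in> nodes T \<Longrightarrow> v' \<in> nodes T' \<Longrightarrow> d (v, v') \<le> d' (v, v')"
  shows "lifting f d (successor T w) (successor T' w')
       \<le> lifting f d' (successor T w) (successor T' w')"
proof (cases "\<exists>b. label T w = Inr b \<and> label T' w' = Inr b")
  case True
  then obtain b where b: "label T w = Inr b" "label T' w' = Inr b" by blast
  note c = label_children[OF T(1) w(1) b(1)] label_children[OF T(2) w(2) b(2)]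
  have "f (d (w @ [False], w' @ [False]), d (w @ [True], w' @ [True]))
      \<le> f (d' (w @ [False], w' @ [False]), d' (w @ [True], w' @ [True]))"
    by (rule mono_onD[OF f]) (use c d d' le in \<open>auto simp: Pi_iff\<close>)
  then show ?thesis using b by (simp add: lifting_def successor_def)
next
  case False
  then show ?thesis by (auto simp: lifting_def successor_def split: sum.splits)
qed

lemma lifting_range:
  assumes f: "f \<in> {0..1} \<times> {0..1} \<rightarrow> {0..1}"
    and T: "labelled_binary_tree T" "labelled_binary_tree T'"
    and w: "w \<in> nodes T" "w' \<in> nodes T'"
    and d: "d \<in> nodes T \<times> nodes T' \<rightarrow> {0..1}"
  shows "lifting f d (successor T w) (successor T' w') \<in> {0..1}"
proof (cases "\<exists>b. label T w = Inr b \<and> label T' w' = Inr b")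
  case True
  then obtain b where b: "label T w = Inr b" "label T' w' = Inr b" by blast
  note c = label_children[OF T(1) w(1) b(1)] label_children[OF T(2) w(2) b(2)]
  have "f (d (w @ [False], w' @ [False]), d (w @ [True], w' @ [True])) \<in> {0..1}"
    by (rule funcset_mem[OF f]) (use c d in \<open>auto simp: Pi_iff\<close>)
  then show ?thesis using b by (simp add: lifting_def successor_def)
next
  case False
  then show ?thesis by (auto simp: lifting_def successor_def split: sum.splits)
qed

lemma least_bisim_dist_ex:
  assumes f: "f \<in> {0..1} \<times> {0..1} \<rightarrow> {0..1}" "mono_on ({0..1} \<times> {0..1}) f"
    and T: "labelled_binary_tree T" "labelled_binary_tree T'"
  shows "\<exists>d. is_least_bisim_dist f T T' d"
proof -
  let ?P = "nodes T \<times> nodes T'"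
  let ?B = "\<lambda>p. {d p | d. bisim_dist f T T' d}"
  define e where "e = restrict (\<lambda>p. Inf (?B p)) ?P"
  define one where "one = restrict (\<lambda>_. 1::real) ?P"
  have one_fun: "one \<in> ?P \<rightarrow> {0..1}" unfolding one_def by auto
  have one: "bisim_dist f T T' one"
    unfolding bisim_dist_def dist_funs_def
    using lifting_range[OF f(1) T _ _ one_fun] by (auto simp: one_def)
  have range: "d p \<in> {0..1}" if "bisim_dist f T T' d" "p \<in> ?P" for d p
    using that unfolding bisim_dist_def dist_funs_def by (blast dest: PiE_mem)
  have bdd: "bdd_below (?B p)" if "p \<in> ?P" for p
    by (rule bdd_belowI[of _ 0]) (use range that in force)
  have lower: "e p \<le> d p" if "bisim_dist f T T' d" "p \<in> ?P" for d p
  proof -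
    have "Inf (?B p) \<le> d p" by (rule cInf_lower) (use that bdd in auto)
    then show ?thesis using that(2) by (simp add: e_def)
  qed
  have greatest: "c \<le> e p" if "p \<in> ?P" "\<And>d. bisim_dist f T T' d \<Longrightarrow> c \<le> d p" for c p
  proof -
    have "c \<le> Inf (?B p)" by (rule cInf_greatest) (use that one in auto)
    then show ?thesis using that(1) by (simp add: e_def)
  qed
  have e01: "e p \<in> {0..1}" if "p \<in> ?P" for p
  proof -
    have "0 \<le> e p" by (rule greatest) (use that range in auto)
    moreover have "e p \<le> 1" using lower[OF one that] range[OF one that] by simp
    ultimately show ?thesis by simp
  qed
  have e_fun: "e \<in> dist_funs T T'"
    unfolding dist_funs_def by (rule PiE_I) (use e01 in \<open>auto simp: e_def\<close>)
  have "lifting f e (successor T w) (successor T' w') \<le> e (w, w')"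
    if w: "w \<in> nodes T" "w' \<in> nodes T'" for w w'
  proof (rule greatest)
    fix d assume d: "bisim_dist f T T' d"
    have "lifting f e (successor T w) (successor T' w')
        \<le> lifting f d (successor T w) (successor T' w')"
      by (rule lifting_mono[OF f(2) T w]) (use e01 range[OF d] lower[OF d] in auto)
    also have "\<dots> \<le> d (w, w')" using d w by (simp add: bisim_dist_def)
    finally show "lifting f e (successor T w) (successor T' w') \<le> d (w, w')" .
  qed (use w in simp)
  then have "is_least_bisim_dist f T T' e"
    unfolding is_least_bisim_dist_def bisim_dist_def[of f T T' e] using e_fun lower by blast
  then show ?thesis by blast
qed

lemma is_least_bisim_dist_unique:
  assumes "is_least_bisim_dist f T T' d" "is_least_bisim_dist f T T' e"
  shows "d = e"
proof (rule PiE_ext)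
  show "d \<in> nodes T \<times> nodes T' \<rightarrow>\<^sub>E {0..1}" "e \<in> nodes T \<times> nodes T' \<rightarrow>\<^sub>E {0..1}"
    using assms unfolding is_least_bisim_dist_def bisim_dist_def dist_funs_def by blast+
  show "d p = e p" if "p \<in> nodes T \<times> nodes T'" for p
    using assms that unfolding is_least_bisim_dist_def by (meson order_antisym)
qed

lemma least_bisim_dist:
  assumes "f \<in> {0..1} \<times> {0..1} \<rightarrow> {0..1}" "mono_on ({0..1} \<times> {0..1}) f"
    and "labelled_binary_tree T" "labelled_binary_tree T'"
  shows "is_least_bisim_dist f T T' (least_bisim_dist f T T')"
  unfolding least_bisim_dist_def
  using least_bisim_dist_ex[OF assms] is_least_bisim_dist_unique by (metis theI)

lemma labelled_binary_tree_subtree: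
  assumes "labelled_binary_tree T"
  shows "labelled_binary_tree (subtree T w)"
  using assms unfolding labelled_binary_tree_def subtree_def
  by (auto simp flip: append_assoc) (metis append_assoc prefixI prefixE)+

lemma lifting_subtree:
  assumes "\<And>v v'. d (v, v') = e (w @ v, w' @ v')"
  shows "lifting f d (successor (subtree T w) v) (successor (subtree T' w') v')
       = lifting f e (successor T (w @ v)) (successor T' (w' @ v'))"
  using assms by (auto simp: lifting_def successor_def subtree_def split: sum.splits)

lemma bd_subtree:
  assumes f: "f \<in> {0..1} \<times> {0..1} \<rightarrow> {0..1}" "mono_on ({0..1} \<times> {0..1}) f"
    and T: "labelled_binary_tree T" "labelled_binary_tree T'"
    and w: "w \<in> nodes T" "w' \<in> nodes T'"
  shows "bd f (subtree T w) (subtree T' w') [] [] = bd f T T' w w'"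
proof -
  let ?S = "subtree T w" and ?S' = "subtree T' w'"
  let ?d = "least_bisim_dist f T T'" and ?e = "least_bisim_dist f ?S ?S'"
  note S = labelled_binary_tree_subtree[OF T(1), of w] labelled_binary_tree_subtree[OF T(2), of w']
  note d = least_bisim_dist[OF f T] and e = least_bisim_dist[OF f S]
  have nS: "v \<in> nodes ?S \<longleftrightarrow> w @ v \<in> nodes T" "v \<in> nodes ?S' \<longleftrightarrow> w' @ v \<in> nodes T'" for v
    by (simp_all add: subtree_def)
  have dfun: "?d \<in> nodes T \<times> nodes T' \<rightarrow>\<^sub>E {0..1}"
    and efun: "?e \<in> nodes ?S \<times> nodes ?S' \<rightarrow>\<^sub>E {0..1}"
    using d e unfolding is_least_bisim_dist_def bisim_dist_def dist_funs_def by blast+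
  have dpre: "lifting f ?d (successor T x) (successor T' y) \<le> ?d (x, y)"
    if "x \<in> nodes T" "y \<in> nodes T'" for x y
    using d that unfolding is_least_bisim_dist_def bisim_dist_def by blast
  have epre: "lifting f ?e (successor ?S x) (successor ?S' y) \<le> ?e (x, y)"
    if "x \<in> nodes ?S" "y \<in> nodes ?S'" for x y
    using e that unfolding is_least_bisim_dist_def bisim_dist_def by blast
  have e_le: "?e (v, v') \<le> ?d (w @ v, w' @ v')" if v: "v \<in> nodes ?S" "v' \<in> nodes ?S'" for v v'
  proof -
    define g where "g = (\<lambda>(v, v'). ?d (w @ v, w' @ v'))"
    have gfun: "g \<in> nodes ?S \<times> nodes ?S' \<rightarrow>\<^sub>E {0..1}"
    proof (rule PiE_I)
      fix p assume "p \<in> nodes ?S \<times> nodes ?S'"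
      then show "g p \<in> {0..1}"
        using PiE_mem[OF dfun] by (auto simp: g_def nS simp del: atLeastAtMost_iff)
    next
      fix p assume "p \<notin> nodes ?S \<times> nodes ?S'"
      then show "g p = undefined"
        using PiE_arb[OF dfun] by (cases p) (auto simp: g_def nS)
    qed
    have "bisim_dist f ?S ?S' g"
      unfolding bisim_dist_def dist_funs_def
    proof (intro conjI ballI gfun)
      fix x y assume "x \<in> nodes ?S" "y \<in> nodes ?S'"
      then show "lifting f g (successor ?S x) (successor ?S' y) \<le> g (x, y)"
        using dpre[of "w @ x" "w' @ y"] lifting_subtree[of g ?d w w' f T x T' y]
        by (simp add: g_def nS)
    qed
    then have "?e (v, v') \<le> g (v, v')" using e v unfolding is_least_bisim_dist_def by blast
    then show ?thesis by (simp add: g_def)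
  qed
  define h where "h = (\<lambda>(x, y). if (\<exists>v v'. x = w @ v \<and> y = w' @ v')
      then ?e (drop (length w) x, drop (length w') y) else ?d (x, y))"
  have h_sub: "h (w @ v, w' @ v') = ?e (v, v')" for v v' by (simp add: h_def)
  have h_out: "h (x, y) = ?d (x, y)" if "\<not> (\<exists>v v'. x = w @ v \<and> y = w' @ v')" for x y
    using that by (auto simp: h_def)
  have h_cases: thesis if
      "\<And>v v'. x = w @ v \<Longrightarrow> y = w' @ v' \<Longrightarrow> thesis"
      "h (x, y) = ?d (x, y) \<Longrightarrow> thesis" for x y thesis
    using that h_out by blast
  have h_le: "h (x, y) \<le> ?d (x, y)" if "x \<in> nodes T" "y \<in> nodes T'" for x y
    by (rule h_cases[of x y]) (use that e_le h_sub nS in auto)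
  have h01: "h (x, y) \<in> {0..1}" if "x \<in> nodes T" "y \<in> nodes T'" for x y
    by (rule h_cases[of x y])
      (use that PiE_mem[OF efun] PiE_mem[OF dfun] h_sub nS in \<open>auto simp del: atLeastAtMost_iff\<close>)
  have hfun: "h \<in> nodes T \<times> nodes T' \<rightarrow>\<^sub>E {0..1}"
  proof (rule PiE_I)
    fix p assume "p \<in> nodes T \<times> nodes T'"
    then show "h p \<in> {0..1}" using h01 by (cases p) blast
  next
    fix p assume p: "p \<notin> nodes T \<times> nodes T'"
    obtain x y where xy: "p = (x, y)" by force
    show "h p = undefined"
      unfolding xy
      by (rule h_cases[of x y])
        (use p xy PiE_arb[OF efun] PiE_arb[OF dfun] h_sub nS in auto)
  qed
  have "bisim_dist f T T' h"
    unfolding bisim_dist_def dist_funs_def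
  proof (intro conjI ballI hfun)
    fix x y assume xy: "x \<in> nodes T" "y \<in> nodes T'"
    show "lifting f h (successor T x) (successor T' y) \<le> h (x, y)"
    proof (rule h_cases[of x y])
      fix v v' assume v: "x = w @ v" "y = w' @ v'"
      then show ?thesis
        using epre[of v v'] lifting_subtree[of ?e h w w' f T v T' v'] h_sub nS xy by simp
    next
      assume h: "h (x, y) = ?d (x, y)"
      have "lifting f h (successor T x) (successor T' y)
          \<le> lifting f ?d (successor T x) (successor T' y)"
        by (rule lifting_mono[OF f(2) T xy]) (use hfun dfun h_le in \<open>auto simp: PiE_def\<close>)
      then show ?thesis using dpre[OF xy] h by simp
    qed
  qed
  then have "?d (w, w') \<le> h (w, w')" using d w unfolding is_least_bisim_dist_def by blast
  then have "?d (w, w') \<le> ?e ([], [])" using h_sub[of "[]" "[]"] by simp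
  moreover have "?e ([], []) \<le> ?d (w, w')" using e_le[of "[]" "[]"] w nS by simp
  ultimately show ?thesis by (simp add: bd_def)
qed


section \<open>The bisimulation distance game\<close>

datatype position =
    Verifier word word real
  | Falsifier "word \<times> word \<Rightarrow> real"

fun verifier_owned :: "position \<Rightarrow> bool" where
  "verifier_owned (Verifier w w' \<epsilon>) = True"
| "verifier_owned (Falsifier d) = False"

fun moves ::
    "(real \<times> real \<Rightarrow> real) \<Rightarrow> ('a, 'b) ltree \<Rightarrow> ('a, 'b) ltree \<Rightarrow> position \<Rightarrow> position set" where
  "moves f T T' (Verifier w w' \<epsilon>\<^sub>1) =
     {Falsifier d | d. d \<in> dist_funs T T' \<and>
        lifting f d (successor T w) (successor T' w') \<le> \<epsilon>\<^sub>1}"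
| "moves f T T' (Falsifier d) =
     {Verifier v v' \<epsilon>\<^sub>2 | v v' \<epsilon>\<^sub>2. v \<in> nodes T \<and> v' \<in> nodes T' \<and> \<epsilon>\<^sub>2 \<in> {0..1} \<and> d (v, v') \<le> \<epsilon>\<^sub>2}"

text \<open>
  Plays are maximal: a finite play ends in a position whose owner cannot move.
  A strategy of Verifier maps histories (nonempty lists of positions, the current one last)
  to the next position.
\<close>

datatype play = Finite_Play "position list" | Infinite_Play "nat \<Rightarrow> position"

fun is_play ::
    "(real \<times> real \<Rightarrow> real) \<Rightarrow> ('a, 'b) ltree \<Rightarrow> ('a, 'b) ltree \<Rightarrow> position \<Rightarrow> play \<Rightarrow> bool" where
  "is_play f T T' p (Finite_Play ps) \<longleftrightarrow>
     ps \<noteq> [] \<and> hd ps = p \<and>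
     (\<forall>i. Suc i < length ps \<longrightarrow> ps ! Suc i \<in> moves f T T' (ps ! i)) \<and>
     moves f T T' (last ps) = {}"
| "is_play f T T' p (Infinite_Play s) \<longleftrightarrow>
     s 0 = p \<and> (\<forall>i. s (Suc i) \<in> moves f T T' (s i))"

fun won_by_verifier :: "play \<Rightarrow> bool" where
  "won_by_verifier (Finite_Play ps) \<longleftrightarrow> \<not> verifier_owned (last ps)"
| "won_by_verifier (Infinite_Play s) \<longleftrightarrow> True"

definition verifier_strategy ::
    "(real \<times> real \<Rightarrow> real) \<Rightarrow> ('a, 'b) ltree \<Rightarrow> ('a, 'b) ltree \<Rightarrow>
     (position list \<Rightarrow> position) \<Rightarrow> bool" where
  "verifier_strategy f T T' \<sigma> \<longleftrightarrow>
     (\<forall>h. h \<noteq> [] \<longrightarrow> verifier_owned (last h) \<longrightarrow> moves f T T' (last h) \<noteq> {} \<longrightarrow>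
        \<sigma> h \<in> moves f T T' (last h))"

fun consistent :: "(position list \<Rightarrow> position) \<Rightarrow> play \<Rightarrow> bool" where
  "consistent \<sigma> (Finite_Play ps) \<longleftrightarrow>
     (\<forall>i. Suc i < length ps \<longrightarrow> verifier_owned (ps ! i) \<longrightarrow> ps ! Suc i = \<sigma> (take (Suc i) ps))"
| "consistent \<sigma> (Infinite_Play s) \<longleftrightarrow>
     (\<forall>i. verifier_owned (s i) \<longrightarrow> s (Suc i) = \<sigma> (map s [0..<Suc i]))"

definition winning_for_verifier ::
    "(real \<times> real \<Rightarrow> real) \<Rightarrow> ('a, 'b) ltree \<Rightarrow> ('a, 'b) ltree \<Rightarrow> position \<Rightarrow> bool" where
  "winning_for_verifier f T T' p \<longleftrightarrow>
     (\<exists>\<sigma>. verifier_strategy f T T' \<sigma> \<and>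
        (\<forall>\<pi>. is_play f T T' p \<pi> \<longrightarrow> consistent \<sigma> \<pi> \<longrightarrow> won_by_verifier \<pi>))"

end

theory Submission
  imports Defs
begin

text \<open>
  The set of winning positions is the largest set in which Verifier can stay, whatever Falsifier
  does. If the distance is at most \<open>\<epsilon>\<close>, Verifier stays in it by always choosing the least
  bisimulation distance function. Conversely, let \<open>e (v, v')\<close> be the infimum of all \<open>\<epsilon>\<close>
  such that \<open>(v, v', \<epsilon>)\<close> is winning. Every function \<open>d\<close> that Verifier may safely choose
  dominates \<open>e\<close>, so monotonicity of the lifting makes \<open>e\<close> a bisimulation distance function,
  which therefore lies above the least one.
\<close>

text \<open>A strategy that always moves into \<open>W\<close> keeps every consistent play inside
  \<open>W\<close>. Such a play cannot end at a position of Verifier, because there \<open>W\<close>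
  guarantees a further move; infinite plays are won anyway.\<close>

lemma winning_for_verifier_if_invariant:
  assumes p: "W p"
    and ver: "\<And>q. W q \<Longrightarrow> verifier_owned q \<Longrightarrow> \<exists>r\<in>moves f T T' q. W r"
    and fal: "\<And>q r. W q \<Longrightarrow> \<not> verifier_owned q \<Longrightarrow> r \<in> moves f T T' q \<Longrightarrow> W r"
  shows "winning_for_verifier f T T' p"
proof -
  \<comment> \<open>\<open>verifier_strategy\<close> demands a legal move after every history, even
    one whose last position has no successor in \<open>W\<close>. The second branch serves these
    histories with an arbitrary move.\<close>
  define \<sigma> where "\<sigma> h =
    (if \<exists>r\<in>moves f T T' (last h). W r then SOME r. r \<in> moves f T T' (last h) \<and> W r
     else SOME r. r \<in> moves f T T' (last h))" for h
  have \<sigma>W: "\<sigma> h \<in> moves f T T' (last h) \<and> W (\<sigma> h)"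
    if "\<exists>r\<in>moves f T T' (last h). W r" for h
    using that someI_ex[of "\<lambda>r. r \<in> moves f T T' (last h) \<and> W r"] by (auto simp: \<sigma>_def)
  have strat: "verifier_strategy f T T' \<sigma>"
    unfolding verifier_strategy_def
  proof (intro allI impI)
    fix h assume "moves f T T' (last h) \<noteq> {}"
    then show "\<sigma> h \<in> moves f T T' (last h)"
      by (cases "\<exists>r\<in>moves f T T' (last h). W r") (use \<sigma>W in \<open>auto simp: \<sigma>_def some_in_eq\<close>)
  qed
  have "won_by_verifier \<pi>" if \<pi>: "is_play f T T' p \<pi>" "consistent \<sigma> \<pi>" for \<pi>
  proof (cases \<pi>)
    case (Finite_Play ps)
    have inv: "i < length ps \<Longrightarrow> W (ps ! i)" for i
    proof (induction i)
      case 0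
      then show ?case using p \<pi> Finite_Play by (simp add: hd_conv_nth)
    next
      case (Suc i)
      show ?case
      proof (cases "verifier_owned (ps ! i)")
        case True
        \<comment> \<open>The history passed to the strategy includes the current position, hence
          \<open>Suc i\<close> entries.\<close>
        have "last (take (Suc i) ps) = ps ! i"
          using Suc.prems by (simp add: take_Suc_conv_app_nth)
        then have "W (\<sigma> (take (Suc i) ps))"
          using \<sigma>W[of "take (Suc i) ps"] ver[OF _ True] Suc by simp
        then show ?thesis using True \<pi> Finite_Play Suc.prems by simp
      next
        case False
        then show ?thesis using fal[of "ps ! i"] \<pi> Finite_Play Suc by simp
      qed
    qed
    have ps: "ps \<noteq> []" "moves f T T' (last ps) = {}" using \<pi> Finite_Play by auto
    then have "W (last ps)" using inv[of "length ps - 1"] by (simp add: last_conv_nth)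
    then show ?thesis using ver ps(2) Finite_Play by auto
  qed simp
  with strat show ?thesis unfolding winning_for_verifier_def by blast
qed

text \<open>Strategies see the whole history, so from \<open>q\<close> Verifier plays as if
  \<open>p\<close> had come before. Prepending \<open>p\<close> to a finite play from
  \<open>q\<close> leaves its last position, and hence its winner, unchanged.\<close>

lemma winning_for_verifier_move:
  assumes \<sigma>: "verifier_strategy f T T' \<sigma>"
    and win: "\<And>\<pi>. is_play f T T' p \<pi> \<Longrightarrow> consistent \<sigma> \<pi> \<Longrightarrow> won_by_verifier \<pi>"
    and q: "q \<in> moves f T T' p" "verifier_owned p \<Longrightarrow> q = \<sigma> [p]"
  shows "winning_for_verifier f T T' q"
proof -
  define \<tau> where "\<tau> h = \<sigma> (p # h)" for h
  have "verifier_strategy f T T' \<tau>"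
    unfolding verifier_strategy_def
  proof (intro allI impI)
    fix h assume "h \<noteq> []" "verifier_owned (last h)" "moves f T T' (last h) \<noteq> {}"
    then show "\<tau> h \<in> moves f T T' (last h)"
      using \<sigma>[unfolded verifier_strategy_def, rule_format, of "p # h"] by (simp add: \<tau>_def)
  qed
  moreover have "won_by_verifier \<pi>" if \<pi>: "is_play f T T' q \<pi>" "consistent \<tau> \<pi>" for \<pi>
  proof (cases \<pi>)
    case (Finite_Play ps)
    have ps: "ps \<noteq> []" "ps ! 0 = q" using \<pi> Finite_Play by (auto simp: hd_conv_nth)
    have "is_play f T T' p (Finite_Play (p # ps))"
      using \<pi> ps q(1) Finite_Play by (auto simp: nth_Cons split: nat.splits)
    \<comment> \<open>The only new condition concerns the first move, made after the history
      \<open>[p]\<close>; it is the second part of \<open>q\<close>.\<close>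
    moreover have "consistent \<sigma> (Finite_Play (p # ps))"
      using \<pi> ps q(2) Finite_Play by (auto simp: nth_Cons \<tau>_def split: nat.splits)
    ultimately have "won_by_verifier (Finite_Play (p # ps))" by (rule win)
    then show ?thesis using ps Finite_Play by simp
  qed simp
  ultimately show ?thesis unfolding winning_for_verifier_def by blast
qed

lemma winning_Falsifier_move:
  assumes "winning_for_verifier f T T' (Falsifier d)" "q \<in> moves f T T' (Falsifier d)"
  shows "winning_for_verifier f T T' q"
  using assms winning_for_verifier_move[of f T T' _ "Falsifier d" q]
  unfolding winning_for_verifier_def[of _ _ _ "Falsifier d"] by auto

lemma winning_Verifier_move:
  assumes "winning_for_verifier f T T' (Verifier w w' \<epsilon>)"
  shows "\<exists>q\<in>moves f T T' (Verifier w w' \<epsilon>). winning_for_verifier f T T' q"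
proof -
  let ?p = "Verifier w w' \<epsilon>"
  obtain \<sigma> where \<sigma>: "verifier_strategy f T T' \<sigma>"
    and win: "\<And>\<pi>. is_play f T T' ?p \<pi> \<Longrightarrow> consistent \<sigma> \<pi> \<Longrightarrow> won_by_verifier \<pi>"
    using assms unfolding winning_for_verifier_def by blast
  \<comment> \<open>Otherwise \<open>[?p]\<close> would be a complete play, trivially consistent
    with \<open>\<sigma>\<close> and lost by Verifier.\<close>
  have "moves f T T' ?p \<noteq> {}"
    using win[of "Finite_Play [?p]"] by auto
  then have "\<sigma> [?p] \<in> moves f T T' ?p"
    using \<sigma>[unfolded verifier_strategy_def, rule_format, of "[?p]"] by simp
  then show ?thesis using winning_for_verifier_move[OF \<sigma> win] by blast
qed

lemma winning_if_bd_le: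
  assumes f: "f \<in> {0..1} \<times> {0..1} \<rightarrow> {0..1}" "mono_on ({0..1} \<times> {0..1}) f"
    and T: "labelled_binary_tree T" "labelled_binary_tree T'"
    and w: "w \<in> nodes T" "w' \<in> nodes T'"
    and le: "bd f T T' w w' \<le> \<epsilon>"
  shows "winning_for_verifier f T T' (Verifier w w' \<epsilon>)"
proof -
  let ?d = "least_bisim_dist f T T'"
  define W where "W q = (case q of
      Verifier v v' \<delta> \<Rightarrow> v \<in> nodes T \<and> v' \<in> nodes T' \<and> ?d (v, v') \<le> \<delta>
    | Falsifier d \<Rightarrow> d = ?d)" for q
  have d: "bisim_dist f T T' ?d"
    using least_bisim_dist[OF f T] by (simp add: is_least_bisim_dist_def)
  show ?thesis
  proof (rule winning_for_verifier_if_invariant[of W])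
    show "W (Verifier w w' \<epsilon>)" using w le by (simp add: W_def bd_def)
  next
    fix q assume "W q" "verifier_owned q"
    \<comment> \<open>Choosing \<open>?d\<close> is legal: its lifting at \<open>(v, v')\<close> is
      at most \<open>?d (v, v')\<close>, which is at most \<open>\<delta>\<close>.\<close>
    then show "\<exists>r\<in>moves f T T' q. W r"
      using d by (cases q) (force simp: W_def bisim_dist_def)+
  next
    fix q r assume "W q" "\<not> verifier_owned q" "r \<in> moves f T T' q"
    then show "W r" by (cases q) (auto simp: W_def)
  qed
qed

lemma bd_le_if_winning:
  assumes f: "f \<in> {0..1} \<times> {0..1} \<rightarrow> {0..1}" "mono_on ({0..1} \<times> {0..1}) f"
    and T: "labelled_binary_tree T" "labelled_binary_tree T'"
    and w: "w \<in> nodes T" "w' \<in> nodes T'"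
    and \<epsilon>: "\<epsilon> \<in> {0..1}"
    and win: "winning_for_verifier f T T' (Verifier w w' \<epsilon>)"
  shows "bd f T T' w w' \<le> \<epsilon>"
proof -
  let ?P = "nodes T \<times> nodes T'"
  \<comment> \<open>Inserting 1 keeps the set nonempty, as the infimum of the empty set is unspecified.\<close>
  define E where "E = (\<lambda>(v, v'). insert 1
    {\<delta> \<in> {0..1}. winning_for_verifier f T T' (Verifier v v' \<delta>)})"
  define e where "e = restrict (\<lambda>p. Inf (E p)) ?P"
  have E01: "E p \<subseteq> {0..1}" "1 \<in> E p" for p by (auto simp: E_def split: prod.splits)
  have bdd: "bdd_below (E p)" for p by (rule bdd_below_mono[OF bdd_below_Icc E01(1)])
  have lower: "e p \<le> \<delta>" if "p \<in> ?P" "\<delta> \<in> E p" for p \<delta>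
    using cInf_lower[OF that(2) bdd] that(1) by (simp add: e_def)
  have greatest: "c \<le> e p" if "p \<in> ?P" "\<And>\<delta>. \<delta> \<in> E p \<Longrightarrow> c \<le> \<delta>" for c p
    using cInf_greatest[of "E p" c] E01(2) that by (auto simp: e_def)
  have e01: "e p \<in> {0..1}" if "p \<in> ?P" for p
    using greatest[OF that, of 0] lower[OF that E01(2)] E01(1) by fastforce
  have efun: "e \<in> ?P \<rightarrow>\<^sub>E {0..1}"
    by (rule PiE_I) (use e01 in \<open>auto simp: e_def\<close>)
  have "bisim_dist f T T' e"
    unfolding bisim_dist_def dist_funs_def
  proof (intro conjI ballI efun)
    fix v v' assume v: "v \<in> nodes T" "v' \<in> nodes T'"
    show "lifting f e (successor T v) (successor T' v') \<le> e (v, v')"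
    proof (rule greatest)
      fix \<delta> assume "\<delta> \<in> E (v, v')"
      then consider "\<delta> = 1" | "winning_for_verifier f T T' (Verifier v v' \<delta>)"
        by (auto simp: E_def)
      then show "lifting f e (successor T v) (successor T' v') \<le> \<delta>"
      proof cases
        \<comment> \<open>The inserted 1 need not come from a winning position; here the bound holds
          because liftings take values in \<open>{0..1}\<close>.\<close>
        case 1
        then show ?thesis using lifting_range[OF f(1) T v, of e] efun by (auto simp: PiE_def)
      next
        case 2
        then obtain d where d: "d \<in> ?P \<rightarrow>\<^sub>E {0..1}"
          and d_le: "lifting f d (successor T v) (successor T' v') \<le> \<delta>"
          and d_win: "winning_for_verifier f T T' (Falsifier d)"
          using winning_Verifier_move[OF 2] by (auto simp: dist_funs_def)
        \<comment> \<open>Falsifier may answer \<open>d\<close> with the smallest admissible value,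
          \<open>d (x, x')\<close> itself. The resulting position is winning, so this value lies in
          \<open>E (x, x')\<close>.\<close>
        have "e (x, x') \<le> d (x, x')" if x: "x \<in> nodes T" "x' \<in> nodes T'" for x x'
        proof (rule lower)
          have "d (x, x') \<in> {0..1}" using PiE_mem[OF d] x by blast
          then show "d (x, x') \<in> E (x, x')"
            using winning_Falsifier_move[OF d_win, of "Verifier x x' (d (x, x'))"] x
            by (simp add: E_def)
        qed (use x in simp)
        then have "lifting f e (successor T v) (successor T' v')
            \<le> lifting f d (successor T v) (successor T' v')"
          by (intro lifting_mono[OF f(2) T v]) (use efun d in \<open>auto simp: PiE_def\<close>)
        then show ?thesis using d_le by simp
      qed
    qed (use v in simp)
  qed
  then have "bd f T T' w w' \<le> e (w, w')"
    using least_bisim_dist[OF f T] w unfolding is_least_bisim_dist_def bd_def by blast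
  also have "\<dots> \<le> \<epsilon>" by (rule lower) (use w \<epsilon> win in \<open>auto simp: E_def\<close>)
  finally show ?thesis .
qed

theorem theorem3p7:
  fixes f :: "real \<times> real \<Rightarrow> real"
    and T T' :: "('a, 'b) ltree"
    and w w' :: word
    and \<epsilon> :: real
  assumes "f \<in> {0..1} \<times> {0..1} \<rightarrow> {0..1}"
    and "mono_on ({0..1} \<times> {0..1}) f"
    and "labelled_binary_tree T"
    and "labelled_binary_tree T'"
    and "w \<in> nodes T"
    and "w' \<in> nodes T'"
    and "\<epsilon> \<in> {0..1}"
  shows "winning_for_verifier f T T' (Verifier w w' \<epsilon>) \<longleftrightarrow> bd f T T' w w' \<le> \<epsilon>"
  using winning_if_bd_le[OF assms(1-6)] bd_le_if_winning[OF assms] by blast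

end
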